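(* Let $I$ be a transport along paths in a bundle $(E,\pi,M)$. For a path $\gamma\colon J\to M$, $s_0\in J$ and $p\in\pi^{-1}(\gamma(s_0))$, define the lift $\bar\gamma_{s_0,p}\colon J\to E$ of $\gamma$ by $$\bar\gamma_{s_0,p}(t)=I^\gamma_{s_0\to t}(p),\qquad t\in J.$$ Suppose that $I$ satisfies: (a) ($C^1$ smoothness) the path $\bar\gamma_{s_0,p}$ is of class $C^1$ for every $C^1$ path $\gamma\colon J\to M$, every $s_0\in J$ and every $p\in\pi^{-1}(\gamma(s_0))$; (b) (initial uniqueness) if $\gamma_i\colon J_i\to M$, $i=1,2$, are two $C^1$ paths and for some $s_i\in J_i$ one has $\gamma_1(s_1)=\gamma_2(s_2)$ and $\dot\gamma_1(s_1)=\dot\gamma_2(s_2)$, then for $p\in\pi^{-1}(\gamma_1(s_1))=\pi^{-1}(\gamma_2(s_2))$ the lifted paths $\bar\gamma_{i;s_i,p}(t)=I^{\gamma_i}_{s_i\to t}(p)$ have equal tangent vectors at $p$: $\dot{\bar\gamma}_{1;s_1,p}(s_1)=\dot{\bar\gamma}_{2;s_2,p}(s_2)$; (c) (linearization) if $\gamma_i\colon J_i\to M$, $i=1,2$, are two $C^1$ paths and for some $s_i\in J_i$ one has $\gamma_1(s_1)=\gamma_2(s_2)$, then for every $a_1,a_2\in\mathbb K$ there exists a $C^1$ path $\gamma_3\colon J_3\to M$ (generally depending on $a_1,a_2,\gamma_1,\gamma_2$) such that $\gamma_3(s_3)=\gamma_1(s_1)=\gamma_2(s_2)$ for some $s_3\in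 J_3$ and, for $p\in\pi^{-1}(\gamma_3(s_3))$, the lifted path $\bar\gamma_{3;s_3,p}(t)=I^{\gamma_3}_{s_3\to t}(p)$ satisfies $$\dot{\bar\gamma}_{3;s_3,p}(s_3)=a_1\dot{\bar\gamma}_{1;s_1,p}(s_1)+a_2\dot{\bar\gamma}_{2;s_2,p}(s_2).$$ Then $\Delta^I\colon p\mapsto\Delta^I_p$, $p\in E$, where $$\Delta^I_p:=\Bigl\{\tfrac{d}{dt}\Big|_{t=s_0}\bar\gamma_{s_0,p}(t)\ :\ \gamma\colon J\to M\text{ is } C^1 \text{ and injective},\ s_0\in J,\ \gamma(s_0)=\pi(p)\Bigr\}\subseteq T_p(E),$$ is a distribution on $E$ which is a connection on $(E,\pi,M)$, i.e. $\Delta^v_p\oplus\Delta^I_p=T_p(E)$ for all $p\in E$, with $\Delta^v_p=T_p(\pi^{-1}(\pi(p)))$ the vertical distribution.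
   Context: $\mathbb K=\mathbb R$ or $\mathbb C$. $(E,\pi,M)$ is a bundle with bundle space $E$, projection $\pi\colon E\to M$ and base $M$; $M$ and $E$ are $C^1$ manifolds over $\mathbb K$ of finite dimensions $n\ge 1$ and $n+r$, $r\ge 1$. $J$ (also $J_i$) denotes an arbitrary real interval, open or closed at either end; a path in $M$ is a map $\gamma\colon J\to M$ from such an interval. For a $C^1$ path, $\dot\gamma(s)\in T_{\gamma(s)}(M)$ is the tangent vector at $s$ (one-sided derivative at a closed endpoint). A transport along paths in $(E,\pi,M)$ is a map $I$ assigning to every path $\gamma\colon J\to M$ a map $I^\gamma\colon(s,t)\mapsto I^\gamma_{s\to t}$, where $I^\gamma_{s\to t}\colon\pi^{-1}(\gamma(s))\to\pi^{-1}(\gamma(t))$, $s,t\in J$, such that $I^\gamma_{s\to t}\circ I^\gamma_{r\to s}=I^\gamma_{r\to t}$ for all $r,s,t\in J$ and $I^\gamma_{s\to s}=\mathrm{id}_{\pi^{-1}(\gamma(s))}$ for all $s\in J$. A $k$-dimensional distribution on a manifold is an assignment to each point of a $k$-dimensional vector subspace of the tangent space there (no smoothness required). The vertical distribution is $\Delta^v_p=T_p(\pi^{-1}(\pi(p)))$. A connection on $(E,\pi,M)$ is an $n$-dimensional ($n=\dim M$) distribution $\Delta^h$ on $E$ with $\Delta^v_p\oplus\Delta^h_p=T_p(E)$ for all $p\in E$. *)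

theory Defs
  imports "HOL-Analysis.Analysis" "HOL-Library.Function_Algebras"
begin

text \<open>
  The scalar field is a type \<open>'k\<close> of class \<open>{real_normed_field, euclidean_space}\<close>. Its instances
  are \<^typ>\<open>real\<close> and \<^typ>\<open>complex\<close>, and (finite-dimensional commutative real division algebras)
  every instance is isometrically isomorphic to one of these. The dimensions are the
  cardinalities of the finite index types: the base is modelled on \<open>'k ^ 'n\<close> and the bundle space
  on \<open>'k ^ ('n + 'r)\<close>, so that n, r \<open>\<ge>\<close> 1 holds automatically.
\<close>

subsection \<open>Manifolds of class C1 over the scalar field\<close>

text \<open>
  Differentiability is over \<open>'k\<close>: the derivative is multiplication by a Jacobian matrix with
  entries in \<open>'k\<close>. For complex scalars the maps are therefore holomorphic.
\<close>

definition C1_on ::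
  "('k::{real_normed_field,euclidean_space} ^ 'a) set \<Rightarrow> ('k ^ 'a \<Rightarrow> 'k ^ 'b) \<Rightarrow> bool"
  where "C1_on S f \<longleftrightarrow>
    (\<exists>D :: 'k ^ 'a \<Rightarrow> 'k ^ 'a ^ 'b.
      continuous_on S D \<and> (\<forall>x\<in>S. (f has_derivative (\<lambda>v. D x *v v)) (at x)))"

type_synonym ('m, 'k, 'n) chart = "'m set \<times> ('m \<Rightarrow> ('k, 'n) vec)"

text \<open>
  A manifold is a Hausdorff type with an atlas (not necessarily a maximal one). No countability
  axiom is imposed.
\<close>

definition C1_manifold ::
  "('m::t2_space, 'k::{real_normed_field,euclidean_space}, 'n::finite) chart set \<Rightarrow> bool"
  where "C1_manifold A \<longleftrightarrow>
    (\<forall>(U, \<phi>)\<in>A. open U \<and> open (\<phi> ` U) \<and> homeomorphism U (\<phi> ` U) \<phi> (inv_into U \<phi>)) \<and>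
    (\<Union>(U, \<phi>)\<in>A. U) = UNIV \<and>
    (\<forall>(U, \<phi>)\<in>A. \<forall>(V, \<psi>)\<in>A. C1_on (\<phi> ` (U \<inter> V)) (\<psi> \<circ> inv_into U \<phi>))"

definition C1_map ::
  "('e::t2_space, 'k::{real_normed_field,euclidean_space}, 'a::finite) chart set \<Rightarrow>
   ('m::t2_space, 'k, 'b::finite) chart set \<Rightarrow> ('e \<Rightarrow> 'm) \<Rightarrow> bool"
  where "C1_map A B f \<longleftrightarrow>
    continuous_on UNIV f \<and>
    (\<forall>(U, \<phi>)\<in>A. \<forall>(V, \<psi>)\<in>B. C1_on (\<phi> ` (U \<inter> f -` V)) (\<psi> \<circ> f \<circ> inv_into U \<phi>))"

text \<open>
  Embedded submanifolds of dimension k, by slice charts; \<open>C1_manifold (insert (U, \<phi>) A)\<close> says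
  that \<open>(U, \<phi>)\<close> is a chart compatible with the atlas \<open>A\<close>.
\<close>

definition C1_submanifold ::
  "('m::t2_space, 'k::{real_normed_field,euclidean_space}, 'n::finite) chart set \<Rightarrow>
   nat \<Rightarrow> 'm set \<Rightarrow> bool"
  where "C1_submanifold A k S \<longleftrightarrow>
    (\<forall>p\<in>S. \<exists>U \<phi> B. p \<in> U \<and> C1_manifold (insert (U, \<phi>) A) \<and> card B = k \<and>
      \<phi> ` (U \<inter> S) = {y \<in> \<phi> ` U. \<forall>i. i \<notin> B \<longrightarrow> y $ i = 0})"

subsection \<open>Tangent spaces\<close>

text \<open>
  A tangent vector at p is the family of its components in all charts of the atlas around p,
  subject to the usual transformation law under change of chart. The value at a pair that is not a
  chart around p is 0 by convention.
\<close>

type_synonym ('m, 'k, 'n) tvec = "('m, 'k, 'n) chart \<Rightarrow> ('k, 'n) vec"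

definition tangent_space ::
  "('m::t2_space, 'k::{real_normed_field,euclidean_space}, 'n::finite) chart set \<Rightarrow>
   'm \<Rightarrow> ('m, 'k, 'n) tvec set"
  where "tangent_space A p = {v.
    (\<forall>(U, \<phi>)\<in>A. \<forall>(V, \<psi>)\<in>A. p \<in> U \<inter> V \<longrightarrow>
      v (V, \<psi>) = frechet_derivative (\<psi> \<circ> inv_into U \<phi>) (at (\<phi> p)) (v (U, \<phi>))) \<and>
    (\<forall>c. \<not> (c \<in> A \<and> p \<in> fst c) \<longrightarrow> v c = 0)}"

definition tv_scale :: "'k::field \<Rightarrow> ('m, 'k, 'n::finite) tvec \<Rightarrow> ('m, 'k, 'n) tvec"
  where "tv_scale a v = (\<lambda>c. a *s v c)"

interpretation tv: vector_space tv_scale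
  by unfold_locales (simp_all add: tv_scale_def fun_eq_iff vec_eq_iff algebra_simps)

text \<open>
  A path on \<open>J\<close> is a function on the whole real line of which only the values on \<open>J\<close> matter.
  Class C1 presupposes an interval with more than one point; at an endpoint belonging to \<open>J\<close> the
  derivative within \<open>J\<close> is the one-sided one.
\<close>

definition C1_path ::
  "('m::t2_space, 'k::{real_normed_field,euclidean_space}, 'n::finite) chart set \<Rightarrow>
   real set \<Rightarrow> (real \<Rightarrow> 'm) \<Rightarrow> bool"
  where "C1_path A J \<gamma> \<longleftrightarrow>
    is_interval J \<and> (\<exists>a\<in>J. \<exists>b\<in>J. a < b) \<and> continuous_on J \<gamma> \<and>
    (\<forall>(U, \<phi>)\<in>A. \<exists>g. continuous_on {t \<in> J. \<gamma> t \<in> U} g \<and>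
      (\<forall>t\<in>{t \<in> J. \<gamma> t \<in> U}. ((\<phi> \<circ> \<gamma>) has_vector_derivative g t) (at t within J)))"

definition velocity ::
  "('m::t2_space, 'k::{real_normed_field,euclidean_space}, 'n::finite) chart set \<Rightarrow>
   real set \<Rightarrow> (real \<Rightarrow> 'm) \<Rightarrow> real \<Rightarrow> ('m, 'k, 'n) tvec"
  where "velocity A J \<gamma> s = (\<lambda>(U, \<phi>).
    if (U, \<phi>) \<in> A \<and> \<gamma> s \<in> U then vector_derivative (\<phi> \<circ> \<gamma>) (at s within J) else 0)"

text \<open>
  The tangent space at p of a submanifold \<open>S\<close>, as a subset of the ambient tangent space: the
  tangent vectors of the C1 paths in \<open>S\<close> through p.
\<close>

definition submanifold_tangent_space ::
  "('m::t2_space, 'k::{real_normed_field,euclidean_space}, 'n::finite) chart set \<Rightarrow>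
   'm set \<Rightarrow> 'm \<Rightarrow> ('m, 'k, 'n) tvec set"
  where "submanifold_tangent_space A S p =
    {velocity A J c s | J c s. C1_path A J c \<and> c ` J \<subseteq> S \<and> s \<in> J \<and> c s = p}"

definition tv_direct_sum ::
  "('m, 'k::field, 'n::finite) tvec set \<Rightarrow> ('m, 'k, 'n) tvec set \<Rightarrow> ('m, 'k, 'n) tvec set \<Rightarrow> bool"
  where "tv_direct_sum V W T \<longleftrightarrow>
    tv.subspace V \<and> tv.subspace W \<and> V \<inter> W = {0} \<and> {v + w | v w. v \<in> V \<and> w \<in> W} = T"

subsection \<open>Bundles and connections\<close>

text \<open>
  Local triviality is not required, only what gives the tangent spaces of the fibres a meaning: each
  fibre is an embedded submanifold whose dimension is the fibre dimension r. Every locally trivial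
  C1 bundle, and every surjective C1 submersion, is a bundle in this sense.
\<close>

definition C1_bundle ::
  "('e::t2_space, 'k::{real_normed_field,euclidean_space}, 'n::finite + 'r::finite) chart set \<Rightarrow>
   ('e \<Rightarrow> 'm::t2_space) \<Rightarrow> ('m, 'k, 'n) chart set \<Rightarrow> bool"
  where "C1_bundle A\<^sub>E \<pi> A\<^sub>M \<longleftrightarrow>
    C1_manifold A\<^sub>E \<and> C1_manifold A\<^sub>M \<and> C1_map A\<^sub>E A\<^sub>M \<pi> \<and> surj \<pi> \<and>
    (\<forall>x. C1_submanifold A\<^sub>E CARD('r) (\<pi> -` {x}))"

definition is_distribution ::
  "('m::t2_space, 'k::{real_normed_field,euclidean_space}, 'n::finite) chart set \<Rightarrow>
   nat \<Rightarrow> ('m \<Rightarrow> ('m, 'k, 'n) tvec set) \<Rightarrow> bool"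
  where "is_distribution A k \<Delta> \<longleftrightarrow>
    (\<forall>p. \<Delta> p \<subseteq> tangent_space A p \<and> tv.subspace (\<Delta> p) \<and> tv.dim (\<Delta> p) = k)"

definition vertical ::
  "('e::t2_space, 'k::{real_normed_field,euclidean_space}, 'a::finite) chart set \<Rightarrow>
   ('e \<Rightarrow> 'm) \<Rightarrow> 'e \<Rightarrow> ('e, 'k, 'a) tvec set"
  where "vertical A\<^sub>E \<pi> p = submanifold_tangent_space A\<^sub>E (\<pi> -` {\<pi> p}) p"

definition is_connection ::
  "('e::t2_space, 'k::{real_normed_field,euclidean_space}, 'n::finite + 'r::finite) chart set \<Rightarrow>
   ('e \<Rightarrow> 'm::t2_space) \<Rightarrow> ('m, 'k, 'n) chart set \<Rightarrow>
   ('e \<Rightarrow> ('e, 'k, 'n + 'r) tvec set) \<Rightarrow> bool"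
  where "is_connection A\<^sub>E \<pi> A\<^sub>M \<Delta> \<longleftrightarrow>
    is_distribution A\<^sub>E CARD('n) \<Delta> \<and>
    (\<forall>p. tv_direct_sum (vertical A\<^sub>E \<pi> p) (\<Delta> p) (tangent_space A\<^sub>E p))"

subsection \<open>Transports along paths\<close>

text \<open>
  \<open>I J \<gamma> s t\<close> is the transport from s to t along the path \<open>\<gamma>\<close> on \<open>J\<close>, relevant only on the fibre
  over \<open>\<gamma> s\<close>. A path here is an arbitrary map on an interval. The second conjunct says that
  the transport depends only on the restriction of \<open>\<gamma>\<close> to \<open>J\<close>.
\<close>

type_synonym ('e, 'm) transport =
  "real set \<Rightarrow> (real \<Rightarrow> 'm) \<Rightarrow> real \<Rightarrow> real \<Rightarrow> 'e \<Rightarrow> 'e"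

definition is_transport :: "('e \<Rightarrow> 'm) \<Rightarrow> ('e, 'm) transport \<Rightarrow> bool"
  where "is_transport \<pi> I \<longleftrightarrow> (\<forall>J \<gamma>. is_interval J \<longrightarrow>
    (\<forall>s\<in>J. \<forall>t\<in>J. \<forall>p\<in>\<pi> -` {\<gamma> s}. I J \<gamma> s t p \<in> \<pi> -` {\<gamma> t}) \<and>
    (\<forall>\<gamma>'. (\<forall>t\<in>J. \<gamma> t = \<gamma>' t) \<longrightarrow>
      (\<forall>s\<in>J. \<forall>t\<in>J. \<forall>p\<in>\<pi> -` {\<gamma> s}. I J \<gamma> s t p = I J \<gamma>' s t p)) \<and>
    (\<forall>r\<in>J. \<forall>s\<in>J. \<forall>t\<in>J. \<forall>p\<in>\<pi> -` {\<gamma> r}. I J \<gamma> s t (I J \<gamma> r s p) = I J \<gamma> r t p) \<and>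
    (\<forall>s\<in>J. \<forall>p\<in>\<pi> -` {\<gamma> s}. I J \<gamma> s s p = p))"

definition lift :: "('e, 'm) transport \<Rightarrow> real set \<Rightarrow> (real \<Rightarrow> 'm) \<Rightarrow> real \<Rightarrow> 'e \<Rightarrow> real \<Rightarrow> 'e"
  where "lift I J \<gamma> s\<^sub>0 p = (\<lambda>t. I J \<gamma> s\<^sub>0 t p)"

definition transport_distribution ::
  "('e::t2_space, 'k::{real_normed_field,euclidean_space}, 'n::finite + 'r::finite) chart set \<Rightarrow>
   ('e \<Rightarrow> 'm::t2_space) \<Rightarrow> ('m, 'k, 'n) chart set \<Rightarrow> ('e, 'm) transport \<Rightarrow>
   'e \<Rightarrow> ('e, 'k, 'n + 'r) tvec set"
  where "transport_distribution A\<^sub>E \<pi> A\<^sub>M I p =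
    {velocity A\<^sub>E J (lift I J \<gamma> s\<^sub>0 p) s\<^sub>0 | J \<gamma> s\<^sub>0.
       C1_path A\<^sub>M J \<gamma> \<and> inj_on \<gamma> J \<and> s\<^sub>0 \<in> J \<and> \<gamma> s\<^sub>0 = \<pi> p}"

end

theory Submission
  imports Defs
begin

text \<open>
  By initial uniqueness, the velocity at p of a lifted path depends only on the velocity of the path
  in the base, which gives a map F from the tangent space at \<open>\<pi> p\<close> to the tangent space at p. It is
  a section of the differential of \<open>\<pi>\<close>, since a lift projects to the path it lifts. Linearization says
  that linear combinations of values of F are again values of F, and projecting with the differential
  identifies where they are attained, so F is linear. Its range is the transport distribution: every
  tangent vector of the base, also 0, is the velocity of an injective path. The range of a section of
  a linear surjection is a complement of the kernel. The kernel is the vertical space: it has dimension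
  r, it contains the vertical space, and the straight lines in a slice chart of the fibre already
  provide an r-dimensional space of vertical vectors.
\<close>

section \<open>Velocities of paths and the chain rule in charts\<close>

text \<open>A nondegenerate interval has no isolated points. Hence derivatives within
  \<open>J\<close>, one-sided ones included, are unique, and a velocity can be computed by
  exhibiting any derivative.\<close>

lemma C1_path_at_within_neq_bot:
  assumes "C1_path A J \<gamma>" "s \<in> J"
  shows "at s within J \<noteq> bot"
proof -
  have "is_interval J" "\<exists>a\<in>J. \<exists>b\<in>J. a < b"
    using assms by (auto simp: C1_path_def)
  then have "connected J" "\<And>x. J \<noteq> {x}"
    by (auto simp: is_interval_connected_1)
  then show ?thesis
    using connected_imp_perfect[OF _ assms(2)] by (simp add: trivial_limit_within)
qed

lemma velocity_chart:
  assumes "at s within J \<noteq> bot" "(U, \<phi>) \<in> A" "\<gamma> s \<in> U"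
    and "((\<phi> \<circ> \<gamma>) has_vector_derivative w) (at s within J)"
  shows "velocity A J \<gamma> s (U, \<phi>) = w"
  using assms by (simp add: velocity_def vector_derivative_within)

lemma velocity_non_chart:
  assumes "\<not> (c \<in> A \<and> \<gamma> s \<in> fst c)"
  shows "velocity A J \<gamma> s c = 0"
  using assms by (cases c) (auto simp: velocity_def)

lemma C1_path_has_velocity:
  assumes "C1_path A J \<gamma>" "s \<in> J" "(U, \<phi>) \<in> A" "\<gamma> s \<in> U"
  shows "((\<phi> \<circ> \<gamma>) has_vector_derivative velocity A J \<gamma> s (U, \<phi>)) (at s within J)"
proof -
  obtain g where g: "\<forall>t\<in>{t \<in> J. \<gamma> t \<in> U}. ((\<phi> \<circ> \<gamma>) has_vector_derivative g t) (at t within J)"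
    using assms(1,3) unfolding C1_path_def by blast
  then have "((\<phi> \<circ> \<gamma>) has_vector_derivative g s) (at s within J)"
    using assms by blast
  moreover from this have "velocity A J \<gamma> s (U, \<phi>) = g s"
    using assms by (intro velocity_chart C1_path_at_within_neq_bot)
  ultimately show ?thesis by simp
qed

text \<open>Near s the path stays in \<open>U\<close> by continuity, and there
  \<open>h \<circ> \<gamma>\<close> factors through the chart, so the chain rule applies. With h a
  second chart this yields the transformation law of velocities, with
  \<open>h = \<psi> \<circ> f\<close> the action of the differential of f.\<close>

lemma has_vector_derivative_through_chart:
  fixes \<gamma> :: "real \<Rightarrow> 'm::topological_space"
    and \<phi> :: "'m \<Rightarrow> 'a::real_normed_vector" and h :: "'m \<Rightarrow> 'b::real_normed_vector"
  assumes "continuous_on J \<gamma>" "s \<in> J" "open U" "inj_on \<phi> U" "\<gamma> s \<in> U"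
    and \<phi>: "((\<phi> \<circ> \<gamma>) has_vector_derivative w) (at s within J)"
    and h: "((h \<circ> inv_into U \<phi>) has_derivative F) (at (\<phi> (\<gamma> s)))"
  shows "((h \<circ> \<gamma>) has_vector_derivative F w) (at s within J)"
proof -
  have "(\<gamma> \<longlongrightarrow> \<gamma> s) (at s within J)"
    using assms(1,2) by (simp add: continuous_on_def)
  then have "\<forall>\<^sub>F t in at s within J. \<gamma> t \<in> U"
    using assms(3,5) by (rule topological_tendstoD)
  then obtain d where d: "0 < d" "\<And>t. \<lbrakk>t \<in> J; t \<noteq> s; dist t s < d\<rbrakk> \<Longrightarrow> \<gamma> t \<in> U"
    by (auto simp: eventually_at)
  have "((h \<circ> inv_into U \<phi> \<circ> (\<phi> \<circ> \<gamma>)) has_vector_derivative F w) (at s within J)"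
    by (rule vector_derivative_diff_chain_within[OF \<phi>])
      (unfold comp_apply[of \<phi> \<gamma>], rule has_derivative_at_withinI[OF h])
  then show ?thesis
  proof (rule has_vector_derivative_transform_within[OF _ d(1) assms(2)])
    fix t assume "t \<in> J" "dist t s < d"
    then have "\<gamma> t \<in> U"
      using d(2) assms(5) by (cases "t = s") auto
    then show "(h \<circ> inv_into U \<phi> \<circ> (\<phi> \<circ> \<gamma>)) t = (h \<circ> \<gamma>) t"
      using assms(4) by simp
  qed
qed

text \<open>A Frechet derivative is a priori only real linear. The Jacobian matrix over
  \<open>'k\<close> makes it linear over the scalar field, which is stronger for complex
  scalars.\<close>

lemma C1_on_frechet_derivative:
  assumes "C1_on S f" "x \<in> S"
  shows "(f has_derivative frechet_derivative f (at x)) (at x)"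
    and "Vector_Spaces.linear (*s) (*s) (frechet_derivative f (at x))"
proof -
  obtain D where "(f has_derivative (*v) (D x)) (at x)"
    using assms unfolding C1_on_def by blast
  moreover from this have "frechet_derivative f (at x) = (*v) (D x)"
    by (rule frechet_derivative_at[symmetric])
  ultimately show "(f has_derivative frechet_derivative f (at x)) (at x)"
    "Vector_Spaces.linear (*s) (*s) (frechet_derivative f (at x))"
    by (metis, metis matrix_vector_mul_linear_gen)
qed

section \<open>Charts and tangent spaces\<close>

lemma C1_manifold_chart:
  assumes "C1_manifold A" "(U, \<phi>) \<in> A"
  shows "open U" "open (\<phi> ` U)" "inj_on \<phi> U" "continuous_on (\<phi> ` U) (inv_into U \<phi>)"
proof -
  have "open U \<and> open (\<phi> ` U) \<and> homeomorphism U (\<phi> ` U) \<phi> (inv_into U \<phi>)"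
    using assms unfolding C1_manifold_def by fast
  then show "open U" "open (\<phi> ` U)" "inj_on \<phi> U" "continuous_on (\<phi> ` U) (inv_into U \<phi>)"
    unfolding homeomorphism_def by (auto intro: inj_on_inverseI)
qed

lemma C1_manifold_transition:
  assumes "C1_manifold A" "(U, \<phi>) \<in> A" "(V, \<psi>) \<in> A"
  shows "C1_on (\<phi> ` (U \<inter> V)) (\<psi> \<circ> inv_into U \<phi>)"
  using assms unfolding C1_manifold_def by fast

lemma C1_manifold_obtain_chart:
  assumes "C1_manifold A"
  obtains U \<phi> where "(U, \<phi>) \<in> A" "p \<in> U"
proof -
  have "p \<in> (\<Union>(U, \<phi>)\<in>A. U)"
    using assms unfolding C1_manifold_def by simp
  then show ?thesis
    using that by auto
qed

lemma tangent_space_iff: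
  "v \<in> tangent_space A p \<longleftrightarrow>
    (\<forall>U \<phi> V \<psi>. (U, \<phi>) \<in> A \<longrightarrow> (V, \<psi>) \<in> A \<longrightarrow> p \<in> U \<longrightarrow> p \<in> V \<longrightarrow>
      v (V, \<psi>) = frechet_derivative (\<psi> \<circ> inv_into U \<phi>) (at (\<phi> p)) (v (U, \<phi>))) \<and>
    (\<forall>c. \<not> (c \<in> A \<and> p \<in> fst c) \<longrightarrow> v c = 0)"
  unfolding tangent_space_def mem_Collect_eq Ball_def split_paired_All prod.case Int_iff by meson

lemma tangent_spaceI:
  assumes "\<And>U \<phi> V \<psi>. \<lbrakk>(U, \<phi>) \<in> A; (V, \<psi>) \<in> A; p \<in> U; p \<in> V\<rbrakk> \<Longrightarrow>
      v (V, \<psi>) = frechet_derivative (\<psi> \<circ> inv_into U \<phi>) (at (\<phi> p)) (v (U, \<phi>))"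
    and "\<And>c. \<not> (c \<in> A \<and> p \<in> fst c) \<Longrightarrow> v c = 0"
  shows "v \<in> tangent_space A p"
  unfolding tangent_space_iff by (intro conjI allI impI) (fact assms)+

text \<open>The transformation law is the chain rule for the transition map
  \<open>\<psi> \<circ> inv_into U \<phi>\<close>.\<close>

lemma velocity_in_tangent_space:
  assumes A: "C1_manifold A" and \<gamma>: "C1_path A J \<gamma>" "s \<in> J"
  shows "velocity A J \<gamma> s \<in> tangent_space A (\<gamma> s)"
proof -
  have "velocity A J \<gamma> s (V, \<psi>) =
      frechet_derivative (\<psi> \<circ> inv_into U \<phi>) (at (\<phi> (\<gamma> s))) (velocity A J \<gamma> s (U, \<phi>))"
    if "(U, \<phi>) \<in> A" "(V, \<psi>) \<in> A" "\<gamma> s \<in> U" "\<gamma> s \<in> V" for U \<phi> V \<psi>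
  proof (rule velocity_chart)
    have "continuous_on J \<gamma>"
      using \<gamma> by (simp add: C1_path_def)
    have D: "((\<psi> \<circ> inv_into U \<phi>) has_derivative frechet_derivative (\<psi> \<circ> inv_into U \<phi>) (at (\<phi> (\<gamma> s))))
        (at (\<phi> (\<gamma> s)))"
      using that by (intro C1_on_frechet_derivative(1)[OF C1_manifold_transition[OF A]]) auto
    show "((\<psi> \<circ> \<gamma>) has_vector_derivative
        frechet_derivative (\<psi> \<circ> inv_into U \<phi>) (at (\<phi> (\<gamma> s))) (velocity A J \<gamma> s (U, \<phi>))) (at s within J)"
      using C1_manifold_chart[OF A that(1)] \<gamma>(2) that(3)
      by (intro has_vector_derivative_through_chart[OF \<open>continuous_on J \<gamma>\<close> _ _ _ _ C1_path_has_velocity[OF \<gamma> that(1,3)] D])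
    show "at s within J \<noteq> bot"
      using C1_path_at_within_neq_bot \<gamma> .
  qed (use that in simp_all)
  then show ?thesis
    by - (rule tangent_spaceI, assumption, rule velocity_non_chart)
qed

lemma tangent_space_transform:
  assumes "v \<in> tangent_space A p" "(U, \<phi>) \<in> A" "(V, \<psi>) \<in> A" "p \<in> U" "p \<in> V"
  shows "v (V, \<psi>) = frechet_derivative (\<psi> \<circ> inv_into U \<phi>) (at (\<phi> p)) (v (U, \<phi>))"
  by (rule assms(1)[unfolded tangent_space_iff, THEN conjunct1, rule_format, OF assms(2-5)])

lemma tangent_space_outside:
  assumes "v \<in> tangent_space A p" "\<not> (c \<in> A \<and> p \<in> fst c)"
  shows "v c = 0"
  by (rule assms(1)[unfolded tangent_space_iff, THEN conjunct2, rule_format, OF assms(2)])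

text \<open>One component fixes the whole family: transition derivatives give the components in the
  other charts around p, and the convention 0 settles all remaining pairs.\<close>

lemma tangent_space_eqI:
  assumes "v \<in> tangent_space A p" "w \<in> tangent_space A p" "(U, \<phi>) \<in> A" "p \<in> U"
    and "v (U, \<phi>) = w (U, \<phi>)"
  shows "v = w"
proof
  fix c
  show "v c = w c"
  proof (cases "c \<in> A \<and> p \<in> fst c")
    case True
    then obtain V \<psi> where c: "c = (V, \<psi>)" "(V, \<psi>) \<in> A" "p \<in> V"
      by (cases c) auto
    show ?thesis
      unfolding c(1) tangent_space_transform[OF assms(1,3) c(2) assms(4) c(3)]
        tangent_space_transform[OF assms(2,3) c(2) assms(4) c(3)] assms(5) ..
  next
    case False
    then show ?thesis
      using tangent_space_outside[OF assms(1)] tangent_space_outside[OF assms(2)] by simp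
  qed
qed

lemma subspace_tangent_space:
  assumes A: "C1_manifold A"
  shows "tv.subspace (tangent_space A p)"
proof -
  have lin: "Vector_Spaces.linear (*s) (*s) (frechet_derivative (\<psi> \<circ> inv_into U \<phi>) (at (\<phi> p)))"
    if "(U, \<phi>) \<in> A" "(V, \<psi>) \<in> A" "p \<in> U" "p \<in> V" for U \<phi> V \<psi>
    using that by (intro C1_on_frechet_derivative(2)[OF C1_manifold_transition[OF A]]) auto
  show ?thesis
    unfolding tv.subspace_def
  proof (intro conjI ballI allI)
    show "0 \<in> tangent_space A p"
      unfolding tangent_space_iff zero_fun_apply using vec.linear_0[OF lin] by metis
    show "v + w \<in> tangent_space A p" if "v \<in> tangent_space A p" "w \<in> tangent_space A p" for v w
    proof -
      have "(v + w) (V, \<psi>) = frechet_derivative (\<psi> \<circ> inv_into U \<phi>) (at (\<phi> p)) ((v + w) (U, \<phi>))"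
        if "(U, \<phi>) \<in> A" "(V, \<psi>) \<in> A" "p \<in> U" "p \<in> V" for U \<phi> V \<psi>
        using tangent_space_transform[OF \<open>v \<in> _\<close> that] tangent_space_transform[OF \<open>w \<in> _\<close> that]
        by (simp add: vec.linear_add[OF lin[OF that]])
      moreover have "(v + w) c = 0" if "\<not> (c \<in> A \<and> p \<in> fst c)" for c
        using tangent_space_outside[OF \<open>v \<in> _\<close> that] tangent_space_outside[OF \<open>w \<in> _\<close> that] by simp
      ultimately show ?thesis
        by - (rule tangent_spaceI)
    qed
    show "tv_scale a v \<in> tangent_space A p" if "v \<in> tangent_space A p" for a v
    proof -
      have "tv_scale a v (V, \<psi>) = frechet_derivative (\<psi> \<circ> inv_into U \<phi>) (at (\<phi> p)) (tv_scale a v (U, \<phi>))"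
        if "(U, \<phi>) \<in> A" "(V, \<psi>) \<in> A" "p \<in> U" "p \<in> V" for U \<phi> V \<psi>
        using tangent_space_transform[OF \<open>v \<in> _\<close> that]
        by (simp add: tv_scale_def vec.linear_scale[OF lin[OF that]])
      moreover have "tv_scale a v c = 0" if "\<not> (c \<in> A \<and> p \<in> fst c)" for c
        using tangent_space_outside[OF \<open>v \<in> _\<close> that] by (simp add: tv_scale_def)
      ultimately show ?thesis
        by - (rule tangent_spaceI)
    qed
  qed
qed

section \<open>C1 paths with prescribed velocity\<close>

text \<open>In another chart the path is the transition map composed with g, so its derivative is
  the Jacobian at \<open>g t\<close> applied to \<open>g' t\<close>, and both factors vary
  continuously with t.\<close>

lemma C1_path_chart_curve:
  assumes A: "C1_manifold A" "(U, \<phi>) \<in> A"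
    and J: "is_interval J" "\<exists>a\<in>J. \<exists>b\<in>J. a < b"
    and g: "g ` J \<subseteq> \<phi> ` U" "continuous_on J g'"
      "\<And>t. t \<in> J \<Longrightarrow> (g has_vector_derivative g' t) (at t within J)"
  shows "C1_path A J (inv_into U \<phi> \<circ> g)"
proof -
  let ?\<gamma> = "inv_into U \<phi> \<circ> g"
  have cont: "continuous_on J g"
    using g(3) by (auto simp: continuous_on_eq_continuous_within intro: has_vector_derivative_continuous)
  have "continuous_on J ?\<gamma>"
    using C1_manifold_chart(4)[OF A] g(1) cont by (intro continuous_on_compose) (auto elim: continuous_on_subset)
  moreover have "\<exists>h. continuous_on {t \<in> J. ?\<gamma> t \<in> V} h \<and>
      (\<forall>t\<in>{t \<in> J. ?\<gamma> t \<in> V}. ((\<psi> \<circ> ?\<gamma>) has_vector_derivative h t) (at t within J))"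
    if V: "(V, \<psi>) \<in> A" for V \<psi>
  proof -
    let ?K = "{t \<in> J. ?\<gamma> t \<in> V}"
    obtain D where D: "continuous_on (\<phi> ` (U \<inter> V)) D"
      "\<And>y. y \<in> \<phi> ` (U \<inter> V) \<Longrightarrow> ((\<psi> \<circ> inv_into U \<phi>) has_derivative (*v) (D y)) (at y)"
      using C1_manifold_transition[OF A V] unfolding C1_on_def by blast
    \<comment> \<open>\<open>D\<close> is known to be the Jacobian only on the coordinate image of
      the overlap, so g has to be located there.\<close>
    have K: "g t \<in> \<phi> ` (U \<inter> V)" if "t \<in> ?K" for t
    proof
      have "g t \<in> \<phi> ` U"
        using that g(1) by blast
      then show "g t = \<phi> (?\<gamma> t)" "?\<gamma> t \<in> U \<inter> V"
        using that by (auto simp: f_inv_into_f inv_into_into)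
    qed
    have "continuous_on ?K (\<lambda>t. D (g t))"
      using cont K by (intro continuous_on_compose2[OF D(1)]) (auto elim: continuous_on_subset)
    moreover have "continuous_on ?K g'"
      using g(2) by (rule continuous_on_subset) auto
    ultimately have "continuous_on ?K (\<lambda>t. D (g t) *v g' t)"
      unfolding matrix_vector_mult_def by (intro continuous_intros)
    moreover have "((\<psi> \<circ> ?\<gamma>) has_vector_derivative D (g t) *v g' t) (at t within J)" if "t \<in> ?K" for t
      unfolding comp_assoc[symmetric] using that
      by (intro vector_derivative_diff_chain_within[OF g(3)] has_derivative_at_withinI[OF D(2)[OF K]]) auto
    ultimately show ?thesis
      by blast
  qed
  ultimately show ?thesis
    using J unfolding C1_path_def by fast
qed

text \<open>The initial velocity is u whatever e is. Taking e = 0 gives the straight lines needed in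
  slice charts; a nonzero e gives a nonconstant path even when u = 0.\<close>

lemma C1_manifold_quadratic_path:
  fixes A :: "('m::t2_space, 'k::{real_normed_field,euclidean_space}, 'n::finite) chart set"
  assumes A: "C1_manifold A" "(U, \<phi>) \<in> A" and p: "p \<in> U"
  obtains \<epsilon> \<gamma> where "0 < \<epsilon>" "C1_path A {0..\<epsilon>} \<gamma>" "\<gamma> 0 = p" "velocity A {0..\<epsilon>} \<gamma> 0 (U, \<phi>) = u"
    "\<And>t. t \<in> {0..\<epsilon>} \<Longrightarrow> \<gamma> t \<in> U \<and> \<phi> (\<gamma> t) = \<phi> p + t *\<^sub>R u + t\<^sup>2 *\<^sub>R e"
proof -
  define g where "g t = \<phi> p + t *\<^sub>R u + t\<^sup>2 *\<^sub>R e" for t :: real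
  note chart = C1_manifold_chart[OF A]
  have "continuous_on UNIV g"
    unfolding g_def by (intro continuous_intros)
  then have "open (g -` (\<phi> ` U))"
    using chart(2) by (simp add: open_vimage)
  moreover have "0 \<in> g -` (\<phi> ` U)"
    using p by (simp add: g_def)
  ultimately obtain r where r: "0 < r" "ball 0 r \<subseteq> g -` (\<phi> ` U)"
    using openE by blast
  \<comment> \<open>Half the radius puts the closed interval inside the open ball.\<close>
  define \<epsilon> where "\<epsilon> = r / 2"
  have \<epsilon>: "0 < \<epsilon>" "g ` {0..\<epsilon>} \<subseteq> \<phi> ` U"
  proof -
    have "{0..\<epsilon>} \<subseteq> ball 0 r"
      using r(1) by (auto simp: \<epsilon>_def dist_real_def)
    then show "g ` {0..\<epsilon>} \<subseteq> \<phi> ` U"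
      using r(2) by auto
  qed (use r(1) in \<open>simp add: \<epsilon>_def\<close>)
  define \<gamma> where "\<gamma> = inv_into U \<phi> \<circ> g"
  have deriv: "(g has_vector_derivative u + (2 * t) *\<^sub>R e) (at t within {0..\<epsilon>})" for t
    unfolding g_def by (auto intro!: derivative_eq_intros)
  have "\<exists>a\<in>{0..\<epsilon>}. \<exists>b\<in>{0..\<epsilon>}. a < b"
    using \<epsilon>(1) by (meson atLeastAtMost_iff less_imp_le order_refl)
  then have path: "C1_path A {0..\<epsilon>} \<gamma>"
    unfolding \<gamma>_def using \<epsilon>(2) deriv
    by (intro C1_path_chart_curve[OF A, where g' = "\<lambda>t. u + (2 * t) *\<^sub>R e"] continuous_intros)
      (simp_all add: is_interval_cc)
  have \<gamma>: "\<gamma> t \<in> U \<and> \<phi> (\<gamma> t) = g t" if "t \<in> {0..\<epsilon>}" for t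
    using \<epsilon>(2) that by (simp add: \<gamma>_def image_subset_iff inv_into_into f_inv_into_f)
  have "\<gamma> 0 = p"
    using chart(3) p by (simp add: \<gamma>_def g_def)
  moreover have "velocity A {0..\<epsilon>} \<gamma> 0 (U, \<phi>) = u"
  proof (rule velocity_chart)
    show "at 0 within {0..\<epsilon>} \<noteq> bot"
      using C1_path_at_within_neq_bot[OF path] \<epsilon>(1) by simp
    show "((\<phi> \<circ> \<gamma>) has_vector_derivative u) (at 0 within {0..\<epsilon>})"
      using has_vector_derivative_weaken[OF deriv[of 0], of "{0..\<epsilon>}" "\<phi> \<circ> \<gamma>"] \<epsilon>(1) \<gamma> by simp
  qed (use A(2) p \<open>\<gamma> 0 = p\<close> in simp_all)
  ultimately show thesis
    using that \<epsilon>(1) path \<gamma> unfolding g_def by blast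
qed

text \<open>The transport distribution admits only injective base paths, yet every tangent vector of
  the base has to occur as a velocity.\<close>

lemma C1_manifold_injective_path:
  fixes A :: "('m::t2_space, 'k::{real_normed_field,euclidean_space}, 'n::finite) chart set"
  assumes A: "C1_manifold A" "(U, \<phi>) \<in> A" and p: "p \<in> U"
  obtains J \<gamma> s where "C1_path A J \<gamma>" "inj_on \<gamma> J" "s \<in> J" "\<gamma> s = p" "velocity A J \<gamma> s (U, \<phi>) = w"
proof -
  \<comment> \<open>The quadratic term is needed for \<open>w = 0\<close>, where the affine path would be constant.\<close>
  define e :: "'k ^ 'n" where "e = (if w = 0 then 1 else 0)"
  obtain \<epsilon> \<gamma> where \<gamma>: "0 < \<epsilon>" "C1_path A {0..\<epsilon>} \<gamma>" "\<gamma> 0 = p" "velocity A {0..\<epsilon>} \<gamma> 0 (U, \<phi>) = w"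
    "\<And>t. t \<in> {0..\<epsilon>} \<Longrightarrow> \<gamma> t \<in> U \<and> \<phi> (\<gamma> t) = \<phi> p + t *\<^sub>R w + t\<^sup>2 *\<^sub>R e"
    using C1_manifold_quadratic_path[OF A p] by blast
  have "inj_on \<gamma> {0..\<epsilon>}"
  proof
    fix t t' assume t: "t \<in> {0..\<epsilon>}" "t' \<in> {0..\<epsilon>}" "\<gamma> t = \<gamma> t'"
    then have "t *\<^sub>R w + t\<^sup>2 *\<^sub>R e = t' *\<^sub>R w + t'\<^sup>2 *\<^sub>R e"
      using \<gamma>(5)[OF t(1)] \<gamma>(5)[OF t(2)] by simp
    \<comment> \<open>For nonzero w the linear term separates parameters. For w = 0 the squares
      agree, and squaring is injective because the interval starts at 0.\<close>
    then show "t = t'"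
      using t(1,2) by (auto simp: e_def split: if_splits)
  qed
  then show thesis
    using that \<gamma> by (metis atLeastAtMost_iff less_imp_le order_refl)
qed

section \<open>Tangent spaces of submanifolds\<close>

text \<open>A slice chart is only compatible with the atlas. Paths are built in the enlarged atlas
  and then read in the original one.\<close>

lemma C1_path_subset_atlas:
  assumes "C1_path B J \<gamma>" "A \<subseteq> B"
  shows "C1_path A J \<gamma>"
  using assms unfolding C1_path_def by blast

lemma velocity_subset_atlas:
  assumes "(U, \<phi>) \<in> A" "A \<subseteq> B"
  shows "velocity A J \<gamma> s (U, \<phi>) = velocity B J \<gamma> s (U, \<phi>)"
  using assms by (auto simp: velocity_def)

text \<open>Straight lines along the slice stay in S, and the derivative of the change from slice
  chart to given chart is injective, so it carries the coordinate k-space to \<open>W\<close>. This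
  is only a lower bound: a set of path velocities is not visibly a subspace.\<close>

lemma submanifold_tangent_space_contains_subspace:
  fixes A :: "('m::t2_space, 'k::{real_normed_field,euclidean_space}, 'n::finite) chart set"
  assumes S: "C1_submanifold A k S" "p \<in> S" and U: "(U, \<phi>) \<in> A" "p \<in> U"
  obtains W where "vec.subspace W" "vec.dim W = k"
    "\<And>w. w \<in> W \<Longrightarrow> \<exists>v \<in> submanifold_tangent_space A S p. v (U, \<phi>) = w"
proof -
  obtain V \<psi> B where V: "p \<in> V" "C1_manifold (insert (V, \<psi>) A)" "card B = k"
    and slice: "\<psi> ` (V \<inter> S) = {y \<in> \<psi> ` V. \<forall>i. i \<notin> B \<longrightarrow> y $ i = 0}"
    using S unfolding C1_submanifold_def by blast
  let ?A = "insert (V, \<psi>) A"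
  let ?B = "{u :: 'k ^ 'n. \<forall>i. i \<notin> B \<longrightarrow> u $ i = 0}"
  define F where "F = frechet_derivative (\<phi> \<circ> inv_into V \<psi>) (at (\<psi> p))"
  define G where "G = frechet_derivative (\<psi> \<circ> inv_into U \<phi>) (at (\<phi> p))"
  have mem: "(V, \<psi>) \<in> ?A" "(U, \<phi>) \<in> ?A"
    using U(1) by auto
  have F: "Vector_Spaces.linear (*s) (*s) F"
    unfolding F_def using C1_on_frechet_derivative(2)[OF C1_manifold_transition[OF V(2) mem]] V(1) U(2) by simp
  have path: "\<exists>\<epsilon> \<gamma>. 0 < \<epsilon> \<and> C1_path ?A {0..\<epsilon>} \<gamma> \<and> \<gamma> 0 = p \<and>
      velocity ?A {0..\<epsilon>} \<gamma> 0 (U, \<phi>) = F u \<and> G (F u) = u \<and>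
      (\<forall>t\<in>{0..\<epsilon>}. \<gamma> t \<in> V \<and> \<psi> (\<gamma> t) = \<psi> p + t *\<^sub>R u)" for u
  proof -
    obtain \<epsilon> \<gamma> where \<gamma>: "0 < \<epsilon>" "C1_path ?A {0..\<epsilon>} \<gamma>" "\<gamma> 0 = p"
      "velocity ?A {0..\<epsilon>} \<gamma> 0 (V, \<psi>) = u"
      "\<And>t. t \<in> {0..\<epsilon>} \<Longrightarrow> \<gamma> t \<in> V \<and> \<psi> (\<gamma> t) = \<psi> p + t *\<^sub>R u + t\<^sup>2 *\<^sub>R 0"
      using C1_manifold_quadratic_path[OF V(2) mem(1) V(1)] by blast
    let ?v = "velocity ?A {0..\<epsilon>} \<gamma> 0"
    have "?v \<in> tangent_space ?A p"
      using velocity_in_tangent_space[OF V(2) \<gamma>(2), of 0] \<gamma>(1,3) by simp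
    \<comment> \<open>Transforming one velocity to the other chart and back shows that
      \<open>G\<close> is a left inverse of \<open>F\<close>.\<close>
    then have "?v (U, \<phi>) = F (?v (V, \<psi>))" "?v (V, \<psi>) = G (?v (U, \<phi>))"
      unfolding F_def G_def using tangent_space_transform mem V(1) U(2) by metis+
    then show ?thesis
      using \<gamma> by (intro exI[of _ \<epsilon>] exI[of _ \<gamma>]) simp
  qed
  have "inj F"
    using path by (intro inj_on_inverseI[of _ G]) blast
  show thesis
  proof
    have B: "vec.subspace ?B"
      by (rule subspace_substandard_cart)
    show "vec.subspace (F ` ?B)"
      by (rule vec.linear_subspace_image[OF F B])
    have "inj_on F (vec.span ?B)"
      using \<open>inj F\<close> by (rule inj_on_subset) simp
    then show "vec.dim (F ` ?B) = k"
      using vec.dim_image_eq[OF F] dim_substandard_cart[of B] V(3) by simp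
    show "\<exists>v \<in> submanifold_tangent_space A S p. v (U, \<phi>) = w" if w: "w \<in> F ` ?B" for w
    proof -
      obtain u where u: "u \<in> ?B" "w = F u"
        using w by blast
      obtain \<epsilon> \<gamma> where \<gamma>: "0 < \<epsilon>" "C1_path ?A {0..\<epsilon>} \<gamma>" "\<gamma> 0 = p"
        "velocity ?A {0..\<epsilon>} \<gamma> 0 (U, \<phi>) = F u"
        "\<And>t. t \<in> {0..\<epsilon>} \<Longrightarrow> \<gamma> t \<in> V \<and> \<psi> (\<gamma> t) = \<psi> p + t *\<^sub>R u"
        using path[of u] by blast
      \<comment> \<open>Both \<open>\<psi> p\<close> and u vanish outside \<open>B\<close>, so the
        line remains in the slice; injectivity of \<open>\<psi>\<close> on V turns this into
        membership in S.\<close>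
      have "\<gamma> t \<in> S" if t: "t \<in> {0..\<epsilon>}" for t
      proof -
        have "\<psi> p \<in> ?B"
          using slice S(2) V(1) by blast
        then have "\<psi> (\<gamma> t) \<in> ?B"
          using \<gamma>(5)[OF t] u(1) by simp
        then have "\<psi> (\<gamma> t) \<in> \<psi> ` (V \<inter> S)"
          using slice \<gamma>(5)[OF t] by blast
        then show ?thesis
          using \<gamma>(5)[OF t] C1_manifold_chart(3)[OF V(2) mem(1)] by (auto dest: inj_onD)
      qed
      then have "velocity A {0..\<epsilon>} \<gamma> 0 \<in> submanifold_tangent_space A S p"
        unfolding submanifold_tangent_space_def using \<gamma>(1,3) C1_path_subset_atlas[OF \<gamma>(2), of A] by force
      moreover have "velocity A {0..\<epsilon>} \<gamma> 0 (U, \<phi>) = w"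
        using velocity_subset_atlas[OF U(1) subset_insertI] \<gamma>(4) u(2) by metis
      ultimately show ?thesis
        by blast
    qed
  qed
qed

section \<open>The differential of a C1 map\<close>

lemma C1_map_frechet_derivative:
  assumes f: "C1_map A B f" and U: "(U, \<phi>) \<in> A" "p \<in> U" and V: "(V, \<psi>) \<in> B" "f p \<in> V"
  shows "((\<psi> \<circ> f \<circ> inv_into U \<phi>) has_derivative
      frechet_derivative (\<psi> \<circ> f \<circ> inv_into U \<phi>) (at (\<phi> p))) (at (\<phi> p))"
    and "Vector_Spaces.linear (*s) (*s) (frechet_derivative (\<psi> \<circ> f \<circ> inv_into U \<phi>) (at (\<phi> p)))"
proof -
  have "C1_on (\<phi> ` (U \<inter> f -` V)) (\<psi> \<circ> f \<circ> inv_into U \<phi>)"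
    using f U(1) V(1) unfolding C1_map_def by fast
  moreover have "\<phi> p \<in> \<phi> ` (U \<inter> f -` V)"
    using U(2) V(2) by blast
  ultimately show "((\<psi> \<circ> f \<circ> inv_into U \<phi>) has_derivative
      frechet_derivative (\<psi> \<circ> f \<circ> inv_into U \<phi>) (at (\<phi> p))) (at (\<phi> p))"
    "Vector_Spaces.linear (*s) (*s) (frechet_derivative (\<psi> \<circ> f \<circ> inv_into U \<phi>) (at (\<phi> p)))"
    by (rule C1_on_frechet_derivative)+
qed

text \<open>The image path c need agree with \<open>f \<circ> \<gamma>\<close> only on
  \<open>J\<close>. This covers a base path recovered from its lift and the constant projection of a
  path in a fibre.\<close>

lemma velocity_C1_map:
  assumes A: "C1_manifold A" and f: "C1_map A B f" and \<gamma>: "C1_path A J \<gamma>" "s \<in> J"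
    and U: "(U, \<phi>) \<in> A" "\<gamma> s \<in> U" and V: "(V, \<psi>) \<in> B" "f (\<gamma> s) \<in> V"
    and c: "\<And>t. t \<in> J \<Longrightarrow> c t = f (\<gamma> t)"
  shows "velocity B J c s (V, \<psi>) =
    frechet_derivative (\<psi> \<circ> f \<circ> inv_into U \<phi>) (at (\<phi> (\<gamma> s))) (velocity A J \<gamma> s (U, \<phi>))"
proof (rule velocity_chart)
  have "continuous_on J \<gamma>"
    using \<gamma>(1) by (simp add: C1_path_def)
  then have "((\<psi> \<circ> f \<circ> \<gamma>) has_vector_derivative
      frechet_derivative (\<psi> \<circ> f \<circ> inv_into U \<phi>) (at (\<phi> (\<gamma> s))) (velocity A J \<gamma> s (U, \<phi>))) (at s within J)"
    using C1_manifold_chart[OF A U(1)] \<gamma>(2) U(2)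
    by (intro has_vector_derivative_through_chart[OF _ _ _ _ _ C1_path_has_velocity[OF \<gamma> U]
        C1_map_frechet_derivative(1)[OF f U V]])
  then show "((\<psi> \<circ> c) has_vector_derivative
      frechet_derivative (\<psi> \<circ> f \<circ> inv_into U \<phi>) (at (\<phi> (\<gamma> s))) (velocity A J \<gamma> s (U, \<phi>))) (at s within J)"
    by (rule has_vector_derivative_weaken) (use \<gamma>(2) c in auto)
  show "at s within J \<noteq> bot"
    using C1_path_at_within_neq_bot[OF \<gamma>] .
qed (use V c \<gamma>(2) in simp_all)

section \<open>Kernel of a linear map with a section\<close>

text \<open>The range of the section f has dimension n and meets \<open>W\<close> only in 0, so by
  dimension the two span everything. If \<open>w + f x\<close> lies in the kernel, applying
  \<open>P\<close> gives x = 0. The lower bound on the vertical space is thereby turned into an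
  equality.\<close>

lemma kernel_eqI_of_section:
  fixes P :: "'k::field ^ ('n::finite + 'r::finite) \<Rightarrow> 'k ^ 'n"
  assumes P: "Vector_Spaces.linear (*s) (*s) P" and f: "Vector_Spaces.linear (*s) (*s) f"
    and Pf: "\<And>x. P (f x) = x"
    and W: "vec.subspace W" "vec.dim W = CARD('r)" "\<And>w. w \<in> W \<Longrightarrow> P w = 0"
  shows "W = {y. P y = 0}"
proof
  have "inj f"
    using Pf by (rule inj_on_inverseI)
  then have "inj_on f (vec.span UNIV)"
    by (rule inj_on_subset) simp
  then have dim: "vec.dim (range f) = CARD('n)"
    using vec.dim_image_eq[OF f] vec_dim_card by metis
  have f_sub: "vec.subspace (range f)"
    by (intro vec.linear_subspace_image[OF f] vec.subspace_UNIV)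
  let ?S = "{w + h | w h. w \<in> W \<and> h \<in> range f}"
  have "W \<inter> range f = {0}"
    using W(3) Pf vec.subspace_0[OF W(1)] vec.linear_0[OF f] by (auto simp: image_iff) metis+
  then have "vec.dim ?S = CARD('n + 'r)"
    using vec.dim_sums_Int[OF W(1) f_sub] dim W(2) by simp
  then have "vec.span ?S = UNIV"
    using vec.dim_eq_full[of ?S] by (simp add: vec.dimension_def card_cart_basis)
  moreover have "vec.span ?S = ?S"
    using vec.subspace_sums[OF W(1) f_sub] by (rule vec.span_eq_iff[THEN iffD2])
  ultimately have S: "?S = UNIV"
    by simp
  show "{y. P y = 0} \<subseteq> W"
  proof
    fix y assume y: "y \<in> {y. P y = 0}"
    have "y \<in> ?S"
      unfolding S ..
    then obtain w x where "w \<in> W" "y = w + f x"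
      by blast
    moreover from this have "x = 0"
      using y W(3) Pf by (simp add: vec.linear_add[OF P])
    ultimately show "y \<in> W"
      using vec.linear_0[OF f] by simp
  qed
qed (use W(3) in blast)

section \<open>From the transport to a connection\<close>

theorem theorem4p1:
  fixes A\<^sub>E :: "('e::t2_space, 'k::{real_normed_field,euclidean_space}, 'n::finite + 'r::finite) chart set"
    and A\<^sub>M :: "('m::t2_space, 'k, 'n) chart set"
    and \<pi> :: "'e \<Rightarrow> 'm"
    and I :: "('e, 'm) transport"
  assumes C1_bundle: "C1_bundle A\<^sub>E \<pi> A\<^sub>M"
    and transport: "is_transport \<pi> I"
    and smooth: "\<And>J \<gamma> s\<^sub>0 p. \<lbrakk>C1_path A\<^sub>M J \<gamma>; s\<^sub>0 \<in> J; p \<in> \<pi> -` {\<gamma> s\<^sub>0}\<rbrakk>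
      \<Longrightarrow> C1_path A\<^sub>E J (lift I J \<gamma> s\<^sub>0 p)"
    and initial_uniqueness: "\<And>J\<^sub>1 \<gamma>\<^sub>1 s\<^sub>1 J\<^sub>2 \<gamma>\<^sub>2 s\<^sub>2 p.
      \<lbrakk>C1_path A\<^sub>M J\<^sub>1 \<gamma>\<^sub>1; C1_path A\<^sub>M J\<^sub>2 \<gamma>\<^sub>2; s\<^sub>1 \<in> J\<^sub>1; s\<^sub>2 \<in> J\<^sub>2; \<gamma>\<^sub>1 s\<^sub>1 = \<gamma>\<^sub>2 s\<^sub>2;
        velocity A\<^sub>M J\<^sub>1 \<gamma>\<^sub>1 s\<^sub>1 = velocity A\<^sub>M J\<^sub>2 \<gamma>\<^sub>2 s\<^sub>2; p \<in> \<pi> -` {\<gamma>\<^sub>1 s\<^sub>1}\<rbrakk>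
      \<Longrightarrow> velocity A\<^sub>E J\<^sub>1 (lift I J\<^sub>1 \<gamma>\<^sub>1 s\<^sub>1 p) s\<^sub>1 = velocity A\<^sub>E J\<^sub>2 (lift I J\<^sub>2 \<gamma>\<^sub>2 s\<^sub>2 p) s\<^sub>2"
    and linearization: "\<And>J\<^sub>1 \<gamma>\<^sub>1 s\<^sub>1 J\<^sub>2 \<gamma>\<^sub>2 s\<^sub>2 a\<^sub>1 a\<^sub>2.
      \<lbrakk>C1_path A\<^sub>M J\<^sub>1 \<gamma>\<^sub>1; C1_path A\<^sub>M J\<^sub>2 \<gamma>\<^sub>2; s\<^sub>1 \<in> J\<^sub>1; s\<^sub>2 \<in> J\<^sub>2; \<gamma>\<^sub>1 s\<^sub>1 = \<gamma>\<^sub>2 s\<^sub>2\<rbrakk>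
      \<Longrightarrow> \<exists>J\<^sub>3 \<gamma>\<^sub>3 s\<^sub>3. C1_path A\<^sub>M J\<^sub>3 \<gamma>\<^sub>3 \<and> s\<^sub>3 \<in> J\<^sub>3 \<and> \<gamma>\<^sub>3 s\<^sub>3 = \<gamma>\<^sub>1 s\<^sub>1 \<and>
            (\<forall>p\<in>\<pi> -` {\<gamma>\<^sub>3 s\<^sub>3}.
              velocity A\<^sub>E J\<^sub>3 (lift I J\<^sub>3 \<gamma>\<^sub>3 s\<^sub>3 p) s\<^sub>3 =
                tv_scale a\<^sub>1 (velocity A\<^sub>E J\<^sub>1 (lift I J\<^sub>1 \<gamma>\<^sub>1 s\<^sub>1 p) s\<^sub>1) +
                tv_scale a\<^sub>2 (velocity A\<^sub>E J\<^sub>2 (lift I J\<^sub>2 \<gamma>\<^sub>2 s\<^sub>2 p) s\<^sub>2))"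
  shows "is_connection A\<^sub>E \<pi> A\<^sub>M (transport_distribution A\<^sub>E \<pi> A\<^sub>M I)"
proof -
  have A\<^sub>E: "C1_manifold A\<^sub>E" and A\<^sub>M: "C1_manifold A\<^sub>M" and \<pi>: "C1_map A\<^sub>E A\<^sub>M \<pi>"
    and fibre: "\<And>x. C1_submanifold A\<^sub>E CARD('r) (\<pi> -` {x})"
    using C1_bundle unfolding C1_bundle_def by auto
  have "transport_distribution A\<^sub>E \<pi> A\<^sub>M I p \<subseteq> tangent_space A\<^sub>E p \<and>
      tv.subspace (transport_distribution A\<^sub>E \<pi> A\<^sub>M I p) \<and>
      tv.dim (transport_distribution A\<^sub>E \<pi> A\<^sub>M I p) = CARD('n) \<and>
      tv_direct_sum (vertical A\<^sub>E \<pi> p) (transport_distribution A\<^sub>E \<pi> A\<^sub>M I p) (tangent_space A\<^sub>E p)" for p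
  proof -
    obtain U \<phi> where U: "(U, \<phi>) \<in> A\<^sub>E" "p \<in> U"
      using C1_manifold_obtain_chart[OF A\<^sub>E] .
    obtain X \<xi> where X: "(X, \<xi>) \<in> A\<^sub>M" "\<pi> p \<in> X"
      using C1_manifold_obtain_chart[OF A\<^sub>M] .
    \<comment> \<open>\<open>P\<close> is the differential of \<open>\<pi>\<close> at p in
      coordinates; one chart at each end suffices because a tangent vector is determined by one
      component.\<close>
    define P where "P = frechet_derivative (\<xi> \<circ> \<pi> \<circ> inv_into U \<phi>) (at (\<phi> p))"
    have P: "Vector_Spaces.linear (*s) (*s) P"
      unfolding P_def by (rule C1_map_frechet_derivative(2)[OF \<pi> U X])
    let ?T = "tangent_space A\<^sub>E p" and ?H = "transport_distribution A\<^sub>E \<pi> A\<^sub>M I p"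
    define l where "l J \<gamma> s = velocity A\<^sub>E J (lift I J \<gamma> s p) s" for J \<gamma> s
    define x where "x J \<gamma> s = velocity A\<^sub>M J \<gamma> s (X, \<xi>)" for J \<gamma> s
    let ?through = "\<lambda>J \<gamma> s. C1_path A\<^sub>M J \<gamma> \<and> s \<in> J \<and> \<gamma> s = \<pi> p"

    have lift: "C1_path A\<^sub>E J (lift I J \<gamma> s p)" "lift I J \<gamma> s p s = p"
      "\<And>t. t \<in> J \<Longrightarrow> \<pi> (lift I J \<gamma> s p t) = \<gamma> t" if "?through J \<gamma> s" for J \<gamma> s
    proof -
      have "is_interval J"
        using that by (simp add: C1_path_def)
      then show "lift I J \<gamma> s p s = p" "\<And>t. t \<in> J \<Longrightarrow> \<pi> (lift I J \<gamma> s p t) = \<gamma> t"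
        using transport that unfolding is_transport_def lift_def by force+
      show "C1_path A\<^sub>E J (lift I J \<gamma> s p)"
        using smooth that by simp
    qed
    have l_T: "l J \<gamma> s \<in> ?T" if "?through J \<gamma> s" for J \<gamma> s
      using velocity_in_tangent_space[OF A\<^sub>E lift(1)[OF that]] lift(2)[OF that] that unfolding l_def by metis
    \<comment> \<open>The lift projects to the path it lifts, so the differential of
      \<open>\<pi>\<close> returns the base velocity.\<close>
    have P_l: "P (l J \<gamma> s (U, \<phi>)) = x J \<gamma> s" if "?through J \<gamma> s" for J \<gamma> s
      using velocity_C1_map[OF A\<^sub>E \<pi> lift(1)[OF that] _ U(1) _ X(1), of s \<gamma>] lift(2,3)[OF that] that U(2) X(2)
      unfolding l_def x_def P_def by simp

    have "\<exists>J \<gamma> s. ?through J \<gamma> s \<and> inj_on \<gamma> J \<and> x J \<gamma> s = w" for w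
      using C1_manifold_injective_path[OF A\<^sub>M X, of w] unfolding x_def by metis
    \<comment> \<open>One injective representative is fixed for each coordinate velocity;
      injectivity places the values of \<open>F\<close> in the transport distribution.\<close>
    then obtain J\<^sub>w \<gamma>\<^sub>w s\<^sub>w where path:
      "\<And>w. ?through (J\<^sub>w w) (\<gamma>\<^sub>w w) (s\<^sub>w w) \<and> inj_on (\<gamma>\<^sub>w w) (J\<^sub>w w) \<and> x (J\<^sub>w w) (\<gamma>\<^sub>w w) (s\<^sub>w w) = w"
      by metis
    define F where "F w = l (J\<^sub>w w) (\<gamma>\<^sub>w w) (s\<^sub>w w)" for w
    have F_T: "F w \<in> ?T" and PF: "P (F w (U, \<phi>)) = w" for w
      unfolding F_def using l_T P_l path by simp_all
    \<comment> \<open>Equal coordinates mean equal base velocities, so initial uniqueness applies.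
      Here the path may fail to be injective, as may the one supplied by linearization.\<close>
    have F_eq: "l J \<gamma> s = F (x J \<gamma> s)" if "?through J \<gamma> s" for J \<gamma> s
    proof -
      let ?w = "x J \<gamma> s"
      have "velocity A\<^sub>M J \<gamma> s = velocity A\<^sub>M (J\<^sub>w ?w) (\<gamma>\<^sub>w ?w) (s\<^sub>w ?w)"
      proof (rule tangent_space_eqI[OF _ _ X])
        show "velocity A\<^sub>M J \<gamma> s \<in> tangent_space A\<^sub>M (\<pi> p)"
          using velocity_in_tangent_space[OF A\<^sub>M, of J \<gamma> s] that by simp
        show "velocity A\<^sub>M (J\<^sub>w ?w) (\<gamma>\<^sub>w ?w) (s\<^sub>w ?w) \<in> tangent_space A\<^sub>M (\<pi> p)"
          using velocity_in_tangent_space[OF A\<^sub>M, of "J\<^sub>w ?w" "\<gamma>\<^sub>w ?w" "s\<^sub>w ?w"] path[of ?w] by simp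
        show "velocity A\<^sub>M J \<gamma> s (X, \<xi>) = velocity A\<^sub>M (J\<^sub>w ?w) (\<gamma>\<^sub>w ?w) (s\<^sub>w ?w) (X, \<xi>)"
          using path[of ?w] by (simp add: x_def)
      qed
      then show ?thesis
        unfolding l_def F_def using initial_uniqueness that path[of ?w] by simp
    qed
    have H: "?H = range F"
    proof
      show "?H \<subseteq> range F"
        using F_eq unfolding transport_distribution_def l_def by blast
      show "range F \<subseteq> ?H"
        using path unfolding transport_distribution_def F_def l_def by blast
    qed

    \<comment> \<open>Linearization yields some path whose lift has the combined velocity. Applying
      \<open>P\<close> reveals its base velocity as \<open>a *s v + b *s w\<close>, so that lifted
      velocity is the value of \<open>F\<close> there.\<close>
    have F_comb: "F (a *s v + b *s w) = tv_scale a (F v) + tv_scale b (F w)" for a b v w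
    proof -
      have "\<exists>J \<gamma> s. ?through J \<gamma> s \<and> l J \<gamma> s = tv_scale a (F v) + tv_scale b (F w)"
        using linearization[of "J\<^sub>w v" "\<gamma>\<^sub>w v" "J\<^sub>w w" "\<gamma>\<^sub>w w" "s\<^sub>w v" "s\<^sub>w w" a b] path[of v] path[of w]
        unfolding l_def F_def by fastforce
      then obtain J \<gamma> s where c: "?through J \<gamma> s" "l J \<gamma> s = tv_scale a (F v) + tv_scale b (F w)"
        by blast
      have "x J \<gamma> s = a *s v + b *s w"
        using P_l[OF c(1)] unfolding c(2)
        by (simp add: tv_scale_def vec.linear_add[OF P] vec.linear_scale[OF P] PF)
      then show ?thesis
        using F_eq[OF c(1)] c(2) by simp
    qed
    have F_add: "F (v + w) = F v + F w" for v w
      using F_comb[of 1 v 1 w] by simp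
    have F_scale: "F (a *s v) = tv_scale a (F v)" for a v
      using F_comb[of a v 0 0] by simp
    have F: "Vector_Spaces.linear (*s) tv_scale F"
      unfolding Vector_Spaces.linear_iff
      using F_add F_scale vec.vector_space_axioms tv.vector_space_axioms by blast
    \<comment> \<open>The coordinate form of \<open>F\<close> is the section of \<open>P\<close>
      used in the dimension count.\<close>
    have F\<^sub>c: "Vector_Spaces.linear (*s) (*s) (\<lambda>w. F w (U, \<phi>))"
      unfolding Vector_Spaces.linear_iff by (intro conjI vec.vector_space_axioms) (simp_all add: F_add F_scale tv_scale_def)
    interpret F: finite_dimensional_vector_space_pair_1 "(*s)" "cart_basis :: ('k ^ 'n) set" tv_scale ..

    \<comment> \<open>Paths in a fibre project to a constant, which gives one inclusion. The other
      follows from the r-dimensional space of vertical vectors, which must fill the kernel.\<close>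
    have V: "vertical A\<^sub>E \<pi> p = {v \<in> ?T. P (v (U, \<phi>)) = 0}"
    proof
      have vert: "v \<in> ?T \<and> P (v (U, \<phi>)) = 0" if v: "v \<in> vertical A\<^sub>E \<pi> p" for v
      proof -
        obtain J c s where c: "v = velocity A\<^sub>E J c s" "C1_path A\<^sub>E J c" "c ` J \<subseteq> \<pi> -` {\<pi> p}" "s \<in> J" "c s = p"
          using v unfolding vertical_def submanifold_tangent_space_def by blast
        have "P (v (U, \<phi>)) = velocity A\<^sub>M J (\<lambda>_. \<pi> p) s (X, \<xi>)"
          using velocity_C1_map[OF A\<^sub>E \<pi> c(2,4) U(1) _ X(1), of "\<lambda>_. \<pi> p"] c(3,5) U(2) X(2)
          unfolding c(1) P_def by (auto simp: image_subset_iff)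
        also have "\<dots> = 0"
          using C1_path_at_within_neq_bot[OF c(2,4)] X by (intro velocity_chart) (simp_all add: comp_def)
        finally show ?thesis
          using velocity_in_tangent_space[OF A\<^sub>E c(2,4)] c(1,5) by simp
      qed
      then show "vertical A\<^sub>E \<pi> p \<subseteq> {v \<in> ?T. P (v (U, \<phi>)) = 0}"
        by blast
      obtain W where W: "vec.subspace W" "vec.dim W = CARD('r)"
        "\<And>w. w \<in> W \<Longrightarrow> \<exists>v \<in> vertical A\<^sub>E \<pi> p. v (U, \<phi>) = w"
        using submanifold_tangent_space_contains_subspace[OF fibre _ U] unfolding vertical_def
        by (metis vimage_singleton_eq)
      have W_ker: "W = {y. P y = 0}"
        using kernel_eqI_of_section[OF P F\<^sub>c PF W(1,2)] W(3) vert by blast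
      show "{v \<in> ?T. P (v (U, \<phi>)) = 0} \<subseteq> vertical A\<^sub>E \<pi> p"
      proof
        fix v assume v: "v \<in> {v \<in> ?T. P (v (U, \<phi>)) = 0}"
        then obtain v' where v': "v' \<in> vertical A\<^sub>E \<pi> p" "v' (U, \<phi>) = v (U, \<phi>)"
          using W(3)[of "v (U, \<phi>)"] W_ker by blast
        \<comment> \<open>Both vectors are tangent at p and share their component in the chart, so
          they coincide.\<close>
        then have "v' = v"
          using vert[of v'] v by (intro tangent_space_eqI[OF _ _ U]) auto
        then show "v \<in> vertical A\<^sub>E \<pi> p"
          using v'(1) by simp
      qed
    qed

    have T: "tv.subspace ?T"
      using subspace_tangent_space[OF A\<^sub>E] .
    have V_sub: "tv.subspace (vertical A\<^sub>E \<pi> p)"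
      using T unfolding V tv.subspace_def
      by (simp add: tv_scale_def vec.linear_0[OF P] vec.linear_add[OF P] vec.linear_scale[OF P])
    have H_sub: "tv.subspace ?H"
      unfolding H by (rule F.linear_subspace_image[OF F vec.subspace_UNIV])
    have F0: "F 0 = 0"
      using F_scale[of 0 0] by simp
    have "inj F"
      using PF by (intro inj_on_inverseI[of _ "\<lambda>v. P (v (U, \<phi>))"])
    then have "inj_on F (vec.span UNIV)"
      by (rule inj_on_subset) simp
    then have dim: "tv.dim ?H = CARD('n)"
      unfolding H using F.dim_image_eq[OF F] vec_dim_card by metis
    have "vertical A\<^sub>E \<pi> p \<inter> ?H = {0}"
    proof
      show "vertical A\<^sub>E \<pi> p \<inter> ?H \<subseteq> {0}"
        unfolding V H using PF F0 by auto
      show "{0} \<subseteq> vertical A\<^sub>E \<pi> p \<inter> ?H"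
        using tv.subspace_0 V_sub H_sub by blast
    qed
    moreover have "{v + w |v w. v \<in> vertical A\<^sub>E \<pi> p \<and> w \<in> ?H} = ?T"
    proof
      show "{v + w |v w. v \<in> vertical A\<^sub>E \<pi> p \<and> w \<in> ?H} \<subseteq> ?T"
        unfolding V H using F_T tv.subspace_add[OF T] by blast
      show "?T \<subseteq> {v + w |v w. v \<in> vertical A\<^sub>E \<pi> p \<and> w \<in> ?H}"
      proof
        fix v assume v: "v \<in> ?T"
        \<comment> \<open>This is the horizontal part of v: since \<open>F\<close> is a section of
          \<open>P\<close>, subtracting it leaves a vector in the kernel of the
          differential.\<close>
        let ?h = "F (P (v (U, \<phi>)))"
        have "v - ?h \<in> vertical A\<^sub>E \<pi> p"
          unfolding V using tv.subspace_diff[OF T v F_T] by (simp add: vec.linear_diff[OF P] PF)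
        moreover have "v = (v - ?h) + ?h"
          by simp
        ultimately show "v \<in> {v + w |v w. v \<in> vertical A\<^sub>E \<pi> p \<and> w \<in> ?H}"
          unfolding H by blast
      qed
    qed
    ultimately have "tv_direct_sum (vertical A\<^sub>E \<pi> p) ?H ?T"
      unfolding tv_direct_sum_def using V_sub H_sub by blast
    moreover have "?H \<subseteq> ?T"
      unfolding H using F_T by blast
    ultimately show ?thesis
      using H_sub dim by blast
  qed
  then show ?thesis
    unfolding is_connection_def is_distribution_def by blast
qed

end
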